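(* Let $1/2<a\le b<1$, let $H:[0,\infty)\to[a,b]$ be measurable, and let $X^H$ be fractional Brownian motion with variable Hurst parameter $H$. Then $X^H$ has long-range dependence, i.e. $$\sum_{k=0}^\infty\left|\mathrm{Cor}_{X^H}(t+\delta k,t)\right|=\infty\quad\text{for all }t>0\text{ and }\delta>0 .$$
   Context: $\beta(\cdot,\cdot)$ denotes the Beta function, and for $h\in(1/2,1)$ set $c_h=\left(\frac{h(2h-1)}{\beta(2-2h,\,h-1/2)}\right)^{1/2}$. For measurable $H:[0,\infty)\to(1/2,1)$ write $H_t=H(t)$ and, for $s,t\ge0$, $$K_H(t,s)=\left[c_{H_t}s^{\frac12-H_t}\int_s^t(u-s)^{H_t-\frac32}u^{H_t-\frac12}\,du\right]\mathbf 1_{[0,t]}(s),\qquad R_H(t,s)=\int_0^{s\wedge t}K_H(t,u)K_H(s,u)\,du .$$ Fractional Brownian motion with variable Hurst parameter $H$ (fBMvH) is the centered Gaussian process $X^H=(X^H_t)_{t\ge0}$ starting at zero with covariance function $R_H$. For a second-order process $X$, $\mathrm{Cor}_X(t,s)$ denotes the correlation of $X_t$ and $X_s$. *)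

theory Defs
  imports "HOL-Probability.Probability"
begin

definition fbm_const :: "real \<Rightarrow> real" where
  "fbm_const h = sqrt (h * (2 * h - 1) / Beta (2 - 2 * h) (h - 1 / 2))"

text \<open>
  All integrals are Lebesgue integrals. At the points \<open>s = 0\<close> and \<open>u = s\<close>, where the
  mathematical expression is singular, \<open>0 powr x = 0\<close>; these form null sets for the
  integrals in which they occur.
\<close>

definition fbm_kernel :: "(real \<Rightarrow> real) \<Rightarrow> real \<Rightarrow> real \<Rightarrow> real" where
  "fbm_kernel H t s =
     (fbm_const (H t) * s powr (1 / 2 - H t) *
        (LINT u:{s..t}|lborel. (u - s) powr (H t - 3 / 2) * u powr (H t - 1 / 2)))
     * indicator {0..t} s"

definition fbm_cov :: "(real \<Rightarrow> real) \<Rightarrow> real \<Rightarrow> real \<Rightarrow> real" where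
  "fbm_cov H t s = (LINT u:{0..min s t}|lborel. fbm_kernel H t u * fbm_kernel H s u)"

definition covariance :: "'a measure \<Rightarrow> ('a \<Rightarrow> real) \<Rightarrow> ('a \<Rightarrow> real) \<Rightarrow> real" where
  "covariance M Y Z =
     (\<integral>\<omega>. (Y \<omega> - integral\<^sup>L M Y) * (Z \<omega> - integral\<^sup>L M Z) \<partial>M)"

definition correlation :: "'a measure \<Rightarrow> (real \<Rightarrow> 'a \<Rightarrow> real) \<Rightarrow> real \<Rightarrow> real \<Rightarrow> real" where
  "correlation M X t s =
     covariance M (X t) (X s) /
       (sqrt (covariance M (X t) (X t)) * sqrt (covariance M (X s) (X s)))"

text \<open>
  Constants count as Gaussian, as is needed for a process that starts at zero. A process
  indexed by \<open>[0,\<infinity>)\<close> is a function on \<^typ>\<open>real\<close> whose values at negative times are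
  irrelevant.
\<close>

definition gaussian_rv :: "'a measure \<Rightarrow> ('a \<Rightarrow> real) \<Rightarrow> bool" where
  "gaussian_rv M Y \<longleftrightarrow> Y \<in> borel_measurable M \<and>
     (\<exists>\<mu>. (AE \<omega> in M. Y \<omega> = \<mu>) \<or>
          (\<exists>\<sigma>>0. distributed M lborel Y (normal_density \<mu> \<sigma>)))"

definition gaussian_process :: "'a measure \<Rightarrow> (real \<Rightarrow> 'a \<Rightarrow> real) \<Rightarrow> bool" where
  "gaussian_process M X \<longleftrightarrow>
     (\<forall>t\<ge>0. X t \<in> borel_measurable M) \<and>
     (\<forall>J c. finite J \<and> J \<subseteq> {0..} \<longrightarrow> gaussian_rv M (\<lambda>\<omega>. \<Sum>t\<in>J. c t * X t \<omega>))"

definition fBMvH :: "'a measure \<Rightarrow> (real \<Rightarrow> real) \<Rightarrow> (real \<Rightarrow> 'a \<Rightarrow> real) \<Rightarrow> bool" where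
  "fBMvH M H X \<longleftrightarrow>
     prob_space M \<and> gaussian_process M X \<and>
     (AE \<omega> in M. X 0 \<omega> = 0) \<and>
     (\<forall>t\<ge>0. integral\<^sup>L M (X t) = 0) \<and>
     (\<forall>t\<ge>0. \<forall>s\<ge>0. covariance M (X t) (X s) = fbm_cov H t s)"

definition long_range_dependent :: "'a measure \<Rightarrow> (real \<Rightarrow> 'a \<Rightarrow> real) \<Rightarrow> bool" where
  "long_range_dependent M X \<longleftrightarrow>
     (\<forall>t>0. \<forall>\<delta>>0. (\<Sum>k. ennreal \<bar>correlation M X (t + \<delta> * real k) t\<bar>) = \<infinity>)"

end

theory Submission
  imports Defs
begin

text \<open>
  Fix \<open>t > 0\<close>, let \<open>T \<ge> t\<close> and write \<open>h = H T\<close>. Although \<open>h\<close> varies with \<open>T\<close>, all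
  estimates are uniform over \<open>h \<in> [a, b]\<close>. The covariance of \<open>X\<^sub>T\<close> and
  \<open>X\<^sub>t\<close> is the integral over \<open>[0, t]\<close> of a product of two nonnegative kernels, so it can be
  bounded below by integrating over a short interval near the origin only. There the kernel of
  \<open>X\<^sub>T\<close> is at least \<open>c\<^sub>h T\<^bsup>2h-1\<^esup> / 2\<close> (\<open>fbm_kernel_lower\<close>), whence
  \<open>Cov(X\<^sub>T, X\<^sub>t) \<ge> const \<cdot> c\<^sub>h T\<^bsup>2h-1\<^esup>\<close> (\<open>fbm_cov_lower\<close>).

  Conversely the kernel is at most \<open>const \<cdot> c\<^sub>h T\<^bsup>2h-1\<^esup> s\<^bsup>1/2-h\<^esup>\<close>, and integrating its square
  over \<open>[0, T]\<close> gives a standard deviation of at most \<open>const \<cdot> c\<^sub>h T\<^bsup>h\<^esup>\<close>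
  (\<open>sqrt_fbm_var_upper\<close>). The normalising constant \<open>c\<^sub>h\<close> cancels in the correlation, so only its
  positivity matters and no Beta integral has to be evaluated. Altogether the correlation is at least \<open>const \<cdot> T\<^bsup>h-1\<^esup>\<close>. Since \<open>h > 0\<close>, this
  dominates a multiple of \<open>1 / (T + 1)\<close>, and along an arithmetic progression of times \<open>T\<close> the
  sum diverges with the harmonic series.
\<close>

section \<open>The inner integral of the kernel\<close>

lemma has_bochner_integral_powr_shift:
  fixes e s T :: real
  assumes "e > -1" and "s \<le> T"
  shows "has_bochner_integral lborel
    (\<lambda>x. indicator {s..T} x *\<^sub>R (x - s) powr e) ((T - s) powr (e + 1) / (e + 1))"
proof -
  let ?f = "\<lambda>x::real. indicator {0..T - s} x * x powr e"
  have indicator_eq: "?f = (\<lambda>x. if x \<in> {0..T - s} then x powr e else 0)"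
    by (auto simp: fun_eq_iff)
  have "((\<lambda>x. x powr e) has_integral ((T - s) powr (e + 1) / (e + 1))) {0..T - s}"
    using assms by (intro has_integral_powr_from_0) auto
  then have "(?f has_integral ((T - s) powr (e + 1) / (e + 1))) UNIV"
    by (subst (asm) has_integral_restrict_UNIV [symmetric]) (simp add: indicator_eq)
  then have "integral\<^sup>N lborel ?f = ennreal ((T - s) powr (e + 1) / (e + 1))"
    by (intro nn_integral_has_integral_lborel) auto
  then have "has_bochner_integral lborel ?f ((T - s) powr (e + 1) / (e + 1))"
    using assms by (intro has_bochner_integral_nn_integral) auto
  then have "has_bochner_integral lborel (\<lambda>x. ?f (-s + 1 * x))
      (((T - s) powr (e + 1) / (e + 1)) /\<^sub>R \<bar>1\<bar>)"
    by (rule lborel_has_bochner_integral_real_affine_iff [THEN iffD1, rotated]) simp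
  moreover have "(\<lambda>x. ?f (-s + 1 * x)) = (\<lambda>x. indicator {s..T} x *\<^sub>R (x - s) powr e)"
    by (auto simp: fun_eq_iff indicator_def)
  ultimately show ?thesis by simp
qed

lemma fbm_const_pos:
  assumes "1 / 2 < h" "h < 1"
  shows "fbm_const h > 0"
  using assms by (auto simp: fbm_const_def Beta_def intro!: divide_pos_pos mult_pos_pos Gamma_real_pos)

text \<open>
  The Hurst value and the time are separate arguments here, so that the estimates below concern a
  single exponent \<open>h\<close>.
\<close>

definition fbm_inner :: "real \<Rightarrow> real \<Rightarrow> real \<Rightarrow> real" where
  "fbm_inner h T s = (LINT u:{s..T}|lborel. (u - s) powr (h - 3 / 2) * u powr (h - 1 / 2))"

lemma fbm_inner_integrable:
  fixes h s T :: real
  assumes "1 / 2 < h" "0 \<le> s" "s \<le> T"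
  shows "set_integrable lborel {s..T} (\<lambda>u. (u - s) powr (h - 3 / 2) * u powr (h - 1 / 2))"
  unfolding set_integrable_def
proof (rule Bochner_Integration.integrable_bound)
  show "integrable lborel (\<lambda>u. T powr (h - 1 / 2) * (indicator {s..T} u *\<^sub>R (u - s) powr (h - 3 / 2)))"
    using has_bochner_integral_powr_shift [of "h - 3 / 2" s T] assms
    by (intro integrable_mult_right) (auto simp: has_bochner_integral_iff)
  have "u powr (h - 1 / 2) \<le> T powr (h - 1 / 2)" if "s \<le> u" "u \<le> T" for u
    using assms that by (intro powr_mono2) auto
  then show "AE u in lborel. norm (indicator {s..T} u *\<^sub>R ((u - s) powr (h - 3 / 2) * u powr (h - 1 / 2)))
      \<le> norm (T powr (h - 1 / 2) * (indicator {s..T} u *\<^sub>R (u - s) powr (h - 3 / 2)))"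
    by (intro AE_I2) (auto simp: indicator_def abs_mult mult.commute intro!: mult_right_mono)
qed simp

lemma fbm_inner_nonneg: "fbm_inner h T s \<ge> 0"
  unfolding fbm_inner_def set_lebesgue_integral_def by (intro integral_nonneg_AE AE_I2) auto

text \<open>
  The factor \<open>u powr (h - 1 / 2)\<close> is at most its value at \<open>u = T\<close>; the remaining power of
  \<open>u - s\<close> has an explicit integral.
\<close>

lemma fbm_inner_upper:
  assumes "1 / 2 < h" "0 \<le> s" "s \<le> T"
  shows "fbm_inner h T s \<le> T powr (2 * h - 1) / (h - 1 / 2)"
proof -
  note I = has_bochner_integral_powr_shift [of "h - 3 / 2" s T]
  have "fbm_inner h T s \<le> (LINT u:{s..T}|lborel. T powr (h - 1 / 2) * (u - s) powr (h - 3 / 2))"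
    unfolding fbm_inner_def
  proof (rule set_integral_mono)
    show "set_integrable lborel {s..T} (\<lambda>u. T powr (h - 1 / 2) * (u - s) powr (h - 3 / 2))"
      using I assms by (intro set_integrable_mult_right) (auto simp: has_bochner_integral_iff set_integrable_def)
    fix u assume "u \<in> {s..T}"
    then have "u powr (h - 1 / 2) \<le> T powr (h - 1 / 2)"
      using assms by (intro powr_mono2) auto
    then show "(u - s) powr (h - 3 / 2) * u powr (h - 1 / 2) \<le> T powr (h - 1 / 2) * (u - s) powr (h - 3 / 2)"
      by (simp add: mult.commute mult_right_mono)
  qed (use fbm_inner_integrable assms in auto)
  also have "\<dots> = T powr (h - 1 / 2) * ((T - s) powr (h - 1 / 2) / (h - 1 / 2))"
    using I assms by (simp add: set_lebesgue_integral_def has_bochner_integral_iff mult.left_commute)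
  also have "\<dots> \<le> T powr (h - 1 / 2) * (T powr (h - 1 / 2) / (h - 1 / 2))"
    using assms by (intro mult_left_mono divide_right_mono powr_mono2) auto
  also have "\<dots> = T powr (2 * h - 1) / (h - 1 / 2)"
    using powr_add [of T "h - 1 / 2" "h - 1 / 2"] by simp
  finally show ?thesis .
qed

text \<open>
  Replacing \<open>u\<close> by the smaller \<open>u - s\<close> in the increasing factor merges the integrand into
  \<open>(u - s) powr (2 * h - 2)\<close>. Its integral is \<open>(T - s) powr (2 * h - 1) / (2 * h - 1)\<close>, and the
  denominator is below 1.
\<close>

lemma fbm_inner_lower:
  assumes "1 / 2 < h" "h < 1" "0 \<le> s" "s \<le> T"
  shows "fbm_inner h T s \<ge> (T - s) powr (2 * h - 1)"
proof -
  note I = has_bochner_integral_powr_shift [of "2 * h - 2" s T]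
  have "(T - s) powr (2 * h - 1) \<le> (T - s) powr (2 * h - 1) / (2 * h - 1)"
    using assms by (simp add: pos_le_divide_eq mult_left_le)
  also have "\<dots> = (LINT u:{s..T}|lborel. (u - s) powr (2 * h - 2))"
    using I assms by (simp add: set_lebesgue_integral_def has_bochner_integral_iff)
  also have "\<dots> \<le> fbm_inner h T s"
    unfolding fbm_inner_def
  proof (rule set_integral_mono)
    show "set_integrable lborel {s..T} (\<lambda>u. (u - s) powr (2 * h - 2))"
      using I assms by (auto simp: has_bochner_integral_iff set_integrable_def)
    fix u assume u: "u \<in> {s..T}"
    have "(u - s) powr (2 * h - 2) = (u - s) powr (h - 3 / 2) * (u - s) powr (h - 1 / 2)"
      by (simp add: powr_add [symmetric])
    also have "\<dots> \<le> (u - s) powr (h - 3 / 2) * u powr (h - 1 / 2)"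
      using u assms by (intro mult_left_mono powr_mono2) auto
    finally show "(u - s) powr (2 * h - 2) \<le> (u - s) powr (h - 3 / 2) * u powr (h - 1 / 2)" .
  qed (use fbm_inner_integrable assms in auto)
  finally show ?thesis .
qed

section \<open>Bounds on the kernel\<close>

lemma fbm_kernel_eq:
  "fbm_kernel H T s = fbm_const (H T) * s powr (1 / 2 - H T) * fbm_inner (H T) T s * indicator {0..T} s"
  by (simp add: fbm_kernel_def fbm_inner_def)

text \<open>
  The domain of the inner integral depends on \<open>s\<close>. Written as a case distinction inside an integral
  over the whole line, it is a parametric integral of a jointly measurable function.
\<close>

lemma fbm_kernel_measurable: "fbm_kernel H T \<in> borel_measurable borel"
proof -
  have [measurable]: "fbm_inner (H T) T \<in> borel_measurable borel"
    unfolding fbm_inner_def set_lebesgue_integral_def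
  proof -
    have eq: "(\<lambda>s. LINT u|lborel. indicator {s..T} u *\<^sub>R ((u - s) powr (H T - 3 / 2) * u powr (H T - 1 / 2)))
      = (\<lambda>s. LINT u|lborel. (if s \<le> u \<and> u \<le> T then (u - s) powr (H T - 3 / 2) * u powr (H T - 1 / 2) else 0))"
      by (intro ext Bochner_Integration.integral_cong) (auto simp: indicator_def)
    show "(\<lambda>s. LINT u|lborel. indicator {s..T} u *\<^sub>R ((u - s) powr (H T - 3 / 2) * u powr (H T - 1 / 2)))
        \<in> borel_measurable borel"
      unfolding eq by measurable
  qed
  show ?thesis unfolding fbm_kernel_eq [abs_def] by measurable
qed

lemma fbm_kernel_nonneg:
  assumes "1 / 2 < H T" "H T < 1"
  shows "fbm_kernel H T s \<ge> 0"
  using fbm_const_pos [OF assms] fbm_inner_nonneg [of "H T" T s] by (simp add: fbm_kernel_eq)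

lemma fbm_kernel_upper:
  assumes "1 / 2 < H T" "H T < 1" "0 \<le> s"
  shows "fbm_kernel H T s
    \<le> fbm_const (H T) * T powr (2 * H T - 1) / (H T - 1 / 2) * s powr (1 / 2 - H T)"
proof (cases "s \<le> T")
  case True
  then have "fbm_kernel H T s = (fbm_const (H T) * s powr (1 / 2 - H T)) * fbm_inner (H T) T s"
    using assms by (simp add: fbm_kernel_eq)
  also have "\<dots> \<le> (fbm_const (H T) * s powr (1 / 2 - H T)) * (T powr (2 * H T - 1) / (H T - 1 / 2))"
    using assms True fbm_const_pos [of "H T"] by (intro mult_left_mono fbm_inner_upper) auto
  finally show ?thesis by (simp add: mult_ac)
next
  case False
  then show ?thesis using assms fbm_const_pos [of "H T"] by (auto simp: fbm_kernel_eq)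
qed

text \<open>
  For \<open>s \<le> 1\<close> the factor \<open>s powr (1 / 2 - H T)\<close> is at least 1, whatever the exponent, and for
  \<open>s \<le> T / 2\<close> the inner integral is of the order of \<open>T powr (2 * H T - 1)\<close>. The constant
  \<open>1 / 2\<close> bounds \<open>(1 / 2) powr (2 * H T - 1)\<close> from below, because the exponent is below 1.
\<close>

lemma fbm_kernel_lower:
  assumes "1 / 2 < H T" "H T < 1" "0 < s" "s \<le> 1" "s \<le> T / 2"
  shows "fbm_kernel H T s \<ge> fbm_const (H T) * T powr (2 * H T - 1) / 2"
proof -
  have c: "fbm_const (H T) > 0" using assms fbm_const_pos by blast
  have "T powr (2 * H T - 1) / 2 \<le> T powr (2 * H T - 1) / 2 powr (2 * H T - 1)"
    using assms powr_mono [of "2 * H T - 1" 1 "2::real"] by (intro divide_left_mono) auto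
  also have "\<dots> = (T / 2) powr (2 * H T - 1)"
    using assms by (simp add: powr_divide)
  also have "\<dots> \<le> (T - s) powr (2 * H T - 1)"
    using assms by (intro powr_mono2) auto
  also have "\<dots> \<le> fbm_inner (H T) T s"
    using assms by (intro fbm_inner_lower) auto
  finally have 1: "T powr (2 * H T - 1) / 2 \<le> fbm_inner (H T) T s" .
  have "1 \<le> s powr (1 / 2 - H T)"
    using assms powr_mono2' [of "1 / 2 - H T" s 1] by simp
  then have "1 * (T powr (2 * H T - 1) / 2) \<le> s powr (1 / 2 - H T) * fbm_inner (H T) T s"
    using 1 by (intro mult_mono) auto
  then show ?thesis using c assms by (simp add: fbm_kernel_eq mult.assoc)
qed

section \<open>Bounds on the covariance\<close>

text \<open>
  The pointwise upper bound dominates the product by a multiple of \<open>u powr (1 - H T - H t)\<close>, which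
  is integrable at 0 because the two Hurst values add up to less than 2. Integrability is what makes
  the lower estimate of \<open>fbm_cov_lower\<close> meaningful, since the integral of a nonintegrable function
  is 0 by convention.
\<close>

lemma fbm_kernel_product:
  assumes H: "1 / 2 < H T" "H T < 1" "1 / 2 < H t" "H t < 1" and t: "0 < t"
  defines "D \<equiv> fbm_const (H T) * T powr (2 * H T - 1) / (H T - 1 / 2) *
      (fbm_const (H t) * t powr (2 * H t - 1) / (H t - 1 / 2))"
  shows "set_integrable lborel {0..t} (\<lambda>u. fbm_kernel H T u * fbm_kernel H t u)"
    and "(LINT u:{0..t}|lborel. fbm_kernel H T u * fbm_kernel H t u)
      \<le> D * (t powr (2 - H T - H t) / (2 - H T - H t))"
proof -
  note [measurable] = fbm_kernel_measurable
  have exponent: "1 - H T - H t + 1 = 2 - H T - H t" by simp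
  note I = has_bochner_integral_powr_shift [of "1 - H T - H t" 0 t, unfolded exponent]
  have pos: "0 \<le> fbm_kernel H T u * fbm_kernel H t u" for u
    using H fbm_kernel_nonneg by simp
  have le: "fbm_kernel H T u * fbm_kernel H t u \<le> D * u powr (1 - H T - H t)" if "0 \<le> u" for u
  proof -
    have "fbm_kernel H T u * fbm_kernel H t u
       \<le> (fbm_const (H T) * T powr (2 * H T - 1) / (H T - 1 / 2) * u powr (1 / 2 - H T)) *
         (fbm_const (H t) * t powr (2 * H t - 1) / (H t - 1 / 2) * u powr (1 / 2 - H t))"
      using H that fbm_const_pos [of "H T"]
      by (intro mult_mono fbm_kernel_upper fbm_kernel_nonneg) auto
    also have "\<dots> = D * (u powr (1 / 2 - H T) * u powr (1 / 2 - H t))"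
      by (simp add: D_def)
    also have "u powr (1 / 2 - H T) * u powr (1 / 2 - H t) = u powr (1 - H T - H t)"
      by (simp add: powr_add [symmetric] algebra_simps)
    finally show ?thesis .
  qed
  have int: "set_integrable lborel {0..t} (\<lambda>u. D * u powr (1 - H T - H t))"
    using I H t by (intro set_integrable_mult_right) (auto simp: has_bochner_integral_iff set_integrable_def)
  show int2: "set_integrable lborel {0..t} (\<lambda>u. fbm_kernel H T u * fbm_kernel H t u)"
    unfolding set_integrable_def
  proof (rule Bochner_Integration.integrable_bound)
    show "integrable lborel (\<lambda>u. indicator {0..t} u *\<^sub>R (D * u powr (1 - H T - H t)))"
      using int by (simp add: set_integrable_def)
    have "\<bar>fbm_kernel H T u * fbm_kernel H t u\<bar> \<le> \<bar>D * u powr (1 - H T - H t)\<bar>" if "0 \<le> u" for u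
      using pos [of u] le [OF that] by linarith
    then show "AE u in lborel. norm (indicator {0..t} u *\<^sub>R (fbm_kernel H T u * fbm_kernel H t u))
       \<le> norm (indicator {0..t} u *\<^sub>R (D * u powr (1 - H T - H t)))"
      by (intro AE_I2) (auto simp: indicator_def)
  qed simp
  have "(LINT u:{0..t}|lborel. fbm_kernel H T u * fbm_kernel H t u)
     \<le> (LINT u:{0..t}|lborel. D * u powr (1 - H T - H t))"
    using le by (intro set_integral_mono int int2) auto
  also have "\<dots> = D * (t powr (2 - H T - H t) / (2 - H T - H t))"
    using I H t by (simp add: set_lebesgue_integral_def has_bochner_integral_iff mult.left_commute)
  finally show "(LINT u:{0..t}|lborel. fbm_kernel H T u * fbm_kernel H t u)
      \<le> D * (t powr (2 - H T - H t) / (2 - H T - H t))" .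
qed

text \<open>
  Only the interval \<open>(0, min 1 (t / 2)]\<close> is used: there both kernels obey the lower bound of
  \<open>fbm_kernel_lower\<close>, since \<open>t \<le> T\<close>. Taking \<open>T = t\<close> also shows that variances are positive.
\<close>

lemma fbm_cov_lower:
  assumes H: "1 / 2 < H T" "H T < 1" "1 / 2 < H t" "H t < 1" and t: "0 < t" "t \<le> T"
  shows "fbm_cov H T t \<ge> min 1 (t / 2) *
    (fbm_const (H T) * T powr (2 * H T - 1) / 2 * (fbm_const (H t) * t powr (2 * H t - 1) / 2))"
    (is "_ \<ge> min 1 (t / 2) * ?L")
proof -
  let ?m = "min 1 (t / 2)"
  have "?m * ?L = (LINT u:{0<..?m}|lborel. ?L)"
    using t by (simp add: set_lebesgue_integral_def)
  also have "\<dots> \<le> (LINT u:{0..t}|lborel. fbm_kernel H T u * fbm_kernel H t u)"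
    unfolding set_lebesgue_integral_def
  proof (rule integral_mono)
    show "integrable lborel (\<lambda>u. indicator {0<..?m} u *\<^sub>R ?L)"
      using t by (intro integrable_scaleR_left integrable_real_indicator)
        (auto simp: emeasure_lborel_Ioc)
    show "integrable lborel (\<lambda>u. indicator {0..t} u *\<^sub>R (fbm_kernel H T u * fbm_kernel H t u))"
      using fbm_kernel_product (1) [of H T t] H t by (simp add: set_integrable_def)
    fix u
    show "indicator {0<..?m} u *\<^sub>R ?L \<le> indicator {0..t} u *\<^sub>R (fbm_kernel H T u * fbm_kernel H t u)"
    proof (cases "u \<in> {0<..?m}")
      case True
      then have "?L \<le> fbm_kernel H T u * fbm_kernel H t u"
        using H t fbm_const_pos [of "H t"] by (intro mult_mono fbm_kernel_lower fbm_kernel_nonneg) auto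
      with True t show ?thesis by auto
    next
      case False
      then show ?thesis using H fbm_kernel_nonneg [of H] by (auto simp: indicator_def)
    qed
  qed
  finally show ?thesis using t by (simp add: fbm_cov_def)
qed

text \<open>
  The case \<open>T = t\<close> of \<open>fbm_kernel_product\<close> bounds the variance by a multiple of
  \<open>T powr (4 * h - 2) * T powr (2 - 2 * h) = T powr (2 * h)\<close> with \<open>h = H T\<close>. The remaining
  factors that depend on \<open>h\<close> are replaced by their worst values for \<open>h \<in> {a..b}\<close>, so that besides
  the power of \<open>T\<close> only \<open>fbm_const h\<close> is kept, to cancel the same factor of the covariance.
\<close>

lemma sqrt_fbm_var_upper:
  assumes H: "1 / 2 < a" "a \<le> H T" "H T \<le> b" "b < 1" and T: "0 < T"
  shows "sqrt (fbm_cov H T T) \<le> fbm_const (H T) * T powr H T / ((a - 1 / 2) * sqrt (2 - 2 * b))"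
proof (rule real_le_lsqrt)
  let ?c = "fbm_const (H T)" and ?h = "H T"
  have c: "?c > 0" using H by (intro fbm_const_pos) auto
  show "0 \<le> ?c * T powr ?h / ((a - 1 / 2) * sqrt (2 - 2 * b))"
    using c H by auto
  have "fbm_cov H T T \<le> (?c * T powr (2 * ?h - 1) / (?h - 1 / 2))\<^sup>2 * (T powr (2 - 2 * ?h) / (2 - 2 * ?h))"
    using fbm_kernel_product (2) [of H T T] H T by (simp add: fbm_cov_def power2_eq_square)
  also have "\<dots> \<le> (?c * T powr (2 * ?h - 1) / (a - 1 / 2))\<^sup>2 * (T powr (2 - 2 * ?h) / (2 - 2 * b))"
    using H c T by (intro mult_mono power_mono divide_left_mono) (auto intro!: mult_pos_pos)
  also have "\<dots> = ?c\<^sup>2 * (T powr (2 * ?h - 1) * T powr (2 * ?h - 1) * T powr (2 - 2 * ?h)) / ((a - 1 / 2)\<^sup>2 * (2 - 2 * b))"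
    by (simp add: power_divide power_mult_distrib power2_eq_square)
  also have "T powr (2 * ?h - 1) * T powr (2 * ?h - 1) * T powr (2 - 2 * ?h) = T powr ?h * T powr ?h"
    by (simp add: powr_add [symmetric])
  also have "?c\<^sup>2 * (T powr ?h * T powr ?h) / ((a - 1 / 2)\<^sup>2 * (2 - 2 * b)) = (?c * T powr ?h / ((a - 1 / 2) * sqrt (2 - 2 * b)))\<^sup>2"
    using H by (simp add: power_divide power_mult_distrib) (simp add: power2_eq_square)
  finally show "fbm_cov H T T \<le> (?c * T powr ?h / ((a - 1 / 2) * sqrt (2 - 2 * b)))\<^sup>2" .
qed

lemma fbm_cov_self_pos:
  assumes "1 / 2 < H t" "H t < 1" "0 < t"
  shows "fbm_cov H t t > 0"
proof -
  have "0 < min 1 (t / 2) *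
    (fbm_const (H t) * t powr (2 * H t - 1) / 2 * (fbm_const (H t) * t powr (2 * H t - 1) / 2))"
    using assms fbm_const_pos [of "H t"] by auto
  also have "\<dots> \<le> fbm_cov H t t"
    using assms by (intro fbm_cov_lower) auto
  finally show ?thesis .
qed

section \<open>Divergence of the sum of correlations\<close>

text \<open>
  The quotient of \<open>fbm_cov_lower\<close> by \<open>sqrt_fbm_var_upper\<close> is a multiple of \<open>T powr (H T - 1)\<close>,
  with a factor that depends on \<open>t\<close>, \<open>a\<close> and \<open>b\<close> but not on \<open>T\<close>. The bound is stated with
  \<open>T + 1\<close> in place of \<open>T\<close> because \<open>T powr (H T - 1) \<ge> 1 / T\<close> fails for \<open>T < 1\<close>.
\<close>

lemma fbm_correlation_lower:
  assumes ab: "1 / 2 < a" "b < 1" and H: "\<And>t. t \<ge> 0 \<Longrightarrow> H t \<in> {a..b}" and t: "0 < t"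
  shows "\<exists>A>0. \<forall>T\<ge>t. A / (T + 1) \<le> fbm_cov H T t / (sqrt (fbm_cov H T T) * sqrt (fbm_cov H t t))"
proof -
  \<comment> \<open>\<open>P\<close> collects the factors of the covariance bound, \<open>Q\<close> those of the two standard
      deviations, that do not depend on \<open>T\<close>.\<close>
  define P where "P = min 1 (t / 2) * (fbm_const (H t) * t powr (2 * H t - 1)) / 4"
  define Q where "Q = (a - 1 / 2) * sqrt (2 - 2 * b) / sqrt (fbm_cov H t t)"
  have h: "a \<le> H T" "H T \<le> b" "1 / 2 < H T" "H T < 1" "fbm_const (H T) > 0" if "t \<le> T" for T
    using H [of T] ab t that by (auto intro!: fbm_const_pos)
  have V: "fbm_cov H T T > 0" if "t \<le> T" for T
    using h [OF that] t that by (intro fbm_cov_self_pos) auto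
  have PQ: "P > 0" "Q > 0"
    using t ab h [of t] V [of t] by (auto simp: P_def Q_def)
  show ?thesis
  proof (intro exI [of _ "P * Q"] conjI allI impI)
    show "P * Q > 0" using PQ by simp
    fix T assume T: "t \<le> T"
    let ?h = "H T" and ?c = "fbm_const (H T)"
    have "1 / (T + 1) = (T + 1) powr (- 1)"
      using T t by (simp add: powr_minus_divide)
    also have "\<dots> \<le> (T + 1) powr (?h - 1)"
      using T t h [OF T] by (intro powr_mono) auto
    also have "\<dots> \<le> T powr (?h - 1)"
      using T t h [OF T] by (intro powr_mono2') auto
    finally have 1: "1 / (T + 1) \<le> T powr (?h - 1)" .
    have "P * Q / (T + 1) \<le> P * Q * T powr (?h - 1)"
      using mult_left_mono [OF 1, of "P * Q"] PQ by simp
    also have "T powr (?h - 1) = T powr (2 * ?h - 1) / T powr ?h"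
      by (simp add: powr_diff [symmetric])
    also have "P * Q * (T powr (2 * ?h - 1) / T powr ?h) =
        (P * (?c * T powr (2 * ?h - 1))) /
        (?c * T powr ?h / ((a - 1 / 2) * sqrt (2 - 2 * b)) * sqrt (fbm_cov H t t))"
      using h [OF T] by (simp add: Q_def mult_ac)
    also have "\<dots> \<le> fbm_cov H T t / (sqrt (fbm_cov H T T) * sqrt (fbm_cov H t t))"
    proof (rule frac_le)
      have "P * (?c * T powr (2 * ?h - 1)) = min 1 (t / 2) *
        (?c * T powr (2 * ?h - 1) / 2 * (fbm_const (H t) * t powr (2 * H t - 1) / 2))"
        by (simp add: P_def)
      also have "\<dots> \<le> fbm_cov H T t"
        using T t h [of T] h [of t] by (intro fbm_cov_lower) auto
      finally show *: "P * (?c * T powr (2 * ?h - 1)) \<le> fbm_cov H T t" .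
      have "0 \<le> P * (?c * T powr (2 * ?h - 1))" using PQ h [OF T] by simp
      with * show "0 \<le> fbm_cov H T t" by linarith
      show "0 < sqrt (fbm_cov H T T) * sqrt (fbm_cov H t t)" using V [OF T] V [of t] by simp
      show "sqrt (fbm_cov H T T) * sqrt (fbm_cov H t t)
         \<le> ?c * T powr ?h / ((a - 1 / 2) * sqrt (2 - 2 * b)) * sqrt (fbm_cov H t t)"
        using h [OF T] T t ab V [of t] by (intro mult_right_mono sqrt_fbm_var_upper) auto
    qed
    finally show "P * Q / (T + 1) \<le> fbm_cov H T t / (sqrt (fbm_cov H T T) * sqrt (fbm_cov H t t))" .
  qed
qed

lemma suminf_ennreal_eq_top_if_ge_harmonic:
  fixes f :: "nat \<Rightarrow> real"
  assumes "C > 0" and "\<And>k. C / real (Suc k) \<le> f k"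
  shows "(\<Sum>k. ennreal (f k)) = \<infinity>"
proof (rule ccontr)
  assume "\<not> ?thesis"
  moreover have f: "f k \<ge> 0" for k
    using assms by (meson divide_nonneg_nonneg less_imp_le of_nat_0_le_iff order_trans)
  ultimately have "summable f" by (intro summable_suminf_not_top) auto
  then have "summable (\<lambda>k. f k / C)" by (rule summable_divide)
  moreover have "norm (inverse (real (Suc k))) \<le> f k / C" for k
  proof -
    have "inverse (real (Suc k)) = C / real (Suc k) / C"
      using assms(1) by (simp add: inverse_eq_divide del: of_nat_Suc)
    also have "\<dots> \<le> f k / C"
      using assms by (intro divide_right_mono) auto
    finally show ?thesis by (simp del: of_nat_Suc)
  qed
  ultimately have "summable (\<lambda>k. inverse (real (Suc k)))"
    by (intro summable_comparison_test' [of "\<lambda>k. f k / C" 0 "\<lambda>k. inverse (real (Suc k))"])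
  then have "summable (\<lambda>k. inverse (real k))"
    using summable_Suc_iff [of "\<lambda>k. inverse (real k)"] by blast
  then show False
    using not_summable_harmonic [where ?'a = real] by blast
qed

theorem proposition3p4p3:
  fixes a b :: real and H :: "real \<Rightarrow> real"
    and M :: "'a measure" and X :: "real \<Rightarrow> 'a \<Rightarrow> real"
  assumes "1 / 2 < a" and "a \<le> b" and "b < 1"
    and "H \<in> borel_measurable (lebesgue_on {0..})"
    and "\<And>t. t \<ge> 0 \<Longrightarrow> H t \<in> {a..b}"
    and "fBMvH M H X"
  shows "long_range_dependent M X"
  unfolding long_range_dependent_def
proof (intro allI impI)
  fix t \<delta> :: real assume t: "t > 0" and \<delta>: "\<delta> > 0"
  have "\<exists>A>0. \<forall>T\<ge>t. A / (T + 1) \<le> fbm_cov H T t / (sqrt (fbm_cov H T T) * sqrt (fbm_cov H t t))"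
    by (rule fbm_correlation_lower [of a b H t]) (fact assms t)+
  then obtain A where A: "A > 0"
    and lower: "\<And>T. t \<le> T \<Longrightarrow> A / (T + 1) \<le> fbm_cov H T t / (sqrt (fbm_cov H T T) * sqrt (fbm_cov H t t))"
    by blast
  have cor: "correlation M X T t = fbm_cov H T t / (sqrt (fbm_cov H T T) * sqrt (fbm_cov H t t))"
    if "t \<le> T" for T
    using assms(6) t that by (simp add: fBMvH_def correlation_def)
  show "(\<Sum>k. ennreal \<bar>correlation M X (t + \<delta> * real k) t\<bar>) = \<infinity>"
  proof (rule suminf_ennreal_eq_top_if_ge_harmonic)
    show "A / (t + \<delta> + 1) > 0" using A t \<delta> by simp
    fix k
    let ?T = "t + \<delta> * real k"
    have T: "t \<le> ?T" using \<delta> by simp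
    have "?T + 1 \<le> (t + \<delta> + 1) * real (Suc k)"
      using t \<delta> by (simp add: algebra_simps)
    then have "A / ((t + \<delta> + 1) * real (Suc k)) \<le> A / (?T + 1)"
      using A T t by (intro frac_le) linarith+
    also have "\<dots> \<le> correlation M X ?T t" using lower [OF T] cor [OF T] by simp
    finally show "A / (t + \<delta> + 1) / real (Suc k) \<le> \<bar>correlation M X ?T t\<bar>" by simp
  qed
qed

end
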